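(* Let $(X,L,\mathbf{R})$ and $(X',L',\mathbf{R}')$ be two $2$-reductive square-free solutions. Let $\pi_1,\pi_2\in\mathrm{Aut}((X,L,\mathbf{R}))$ and $\pi_1',\pi_2'\in\mathrm{Aut}((X',L',\mathbf{R}'))$ be such that for all $x,y\in X$ $$L_x\pi_1 L_y=L_{\pi_1(y)}\pi_1L_{\pi_2(x)},\quad \mathbf{R}_x\pi_2 \mathbf{R}_y=\mathbf{R}_{\pi_2(y)}\pi_2\mathbf{R}_{\pi_1(x)},\quad \mathbf{R}_{\pi_1(y)}\pi_2 L_x\pi_1=L_{\pi_2(x)}\pi_1 \mathbf{R}_y\pi_2,$$ and the analogous three identities hold for $\pi_1',\pi_2',L',\mathbf{R}'$ for all $x,y\in X'$. Then the $(\pi_1,\pi_2)$-isotope of $(X,L,\mathbf{R})$ and the $(\pi_1',\pi_2')$-isotope of $(X',L',\mathbf{R}')$ are isomorphic $2$-permutational solutions if and only if there is an isomorphism $\varphi$ from $(X,L,\mathbf{R})$ onto $(X',L',\mathbf{R}')$ such that (1) $\pi_1'=\varphi\pi_1\varphi^{-1}$, and (2) $\pi_2'=\varphi\pi_2\varphi^{-1}$.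
   Context: A solution $(X,\sigma,\tau)$ means a non-degenerate set-theoretic solution of the Yang–Baxter equation: a set $X$ (of arbitrary cardinality) with maps $\sigma,\tau:X^2\to X$, written $\sigma_x(y)=\sigma(x,y)$ and $\tau_y(x)=\tau(x,y)$, such that all $\sigma_x,\tau_y$ are bijections of $X$ and $r(x,y)=(\sigma_x(y),\tau_y(x))$ satisfies the braid relation $(\mathrm{id}\times r)(r\times \mathrm{id})(\mathrm{id}\times r)=(r\times \mathrm{id})(\mathrm{id}\times r)(r\times \mathrm{id})$ on $X^3$. Composition of maps is $(fg)(x)=f(g(x))$. The solution is $2$-permutational if $\sigma_{\sigma_x(z)}=\sigma_{\sigma_y(z)}$, $\tau_{\tau_x(z)}=\tau_{\tau_y(z)}$, $\sigma_{\tau_x(z)}=\sigma_{\tau_y(z)}$, $\tau_{\sigma_x(z)}=\tau_{\sigma_y(z)}$ for all $x,y,z\in X$. It is $2$-reductive if $\sigma_{\sigma_x(y)}=\sigma_y$, $\tau_{\tau_x(y)}=\tau_y$, $\sigma_{\tau_x(y)}=\sigma_y$, $\tau_{\sigma_x(y)}=\tau_y$ for all $x,y\in X$. It is square-free if $r(x,x)=(x,x)$ for all $x\in X$. An isomorphism from $(X,\sigma,\tau)$ to $(X',\sigma',\tau')$ is a bijection $\Phi:X\to X'$ with $\Phi\sigma_x=\sigma'_{\Phi(x)}\Phi$ and $\Phi\tau_x=\tau'_{\Phi(x)}\Phi$ for all $x\in X$; an automorphism is an isomorphism of a solution to itself, and $\mathrm{Aut}$ denotes the group of automorphisms. For a $2$-reductive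 solution $(X,L,\mathbf{R})$ and bijections $\pi_1,\pi_2$ of $X$ satisfying the three displayed identities, the $(\pi_1,\pi_2)$-isotope is the solution $(X,\mu,\nu)$ with $\mu_x=L_x\pi_1$ and $\nu_x=\mathbf{R}_x\pi_2$ (for $2$-reductive $(X,L,\mathbf{R})$ the three identities are equivalent to $(X,\mu,\nu)$ being a solution). *)

theory Defs
  imports Main
begin

text \<open>
  Solutions live on a carrier set \<open>X\<close> (possibly empty).  The subscript is always the first
  argument: \<open>\<sigma> x y\<close> is \<open>\<sigma>\<^sub>x(y)\<close> and \<open>\<tau> y x\<close> is \<open>\<tau>\<^sub>y(x)\<close>, so \<open>\<tau> y x\<close> is the value
  of the binary map \<open>\<tau>\<close> at the pair \<open>(x, y)\<close>.  Values outside \<open>X\<close> are irrelevant;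
  equality of maps on \<open>X\<close> is expressed by \<open>eq_on X\<close>.
\<close>

definition eq_on :: "'a set \<Rightarrow> ('a \<Rightarrow> 'b) \<Rightarrow> ('a \<Rightarrow> 'b) \<Rightarrow> bool" where
  "eq_on X f g \<longleftrightarrow> (\<forall>x\<in>X. f x = g x)"

definition yb_map :: "('a \<Rightarrow> 'a \<Rightarrow> 'a) \<Rightarrow> ('a \<Rightarrow> 'a \<Rightarrow> 'a) \<Rightarrow> 'a \<times> 'a \<Rightarrow> 'a \<times> 'a" where
  "yb_map \<sigma> \<tau> = (\<lambda>(x, y). (\<sigma> x y, \<tau> y x))"

text \<open>\<open>act12 r\<close> and \<open>act23 r\<close> are \<open>r \<times> id\<close> and \<open>id \<times> r\<close> on triples; as HOL triples nest to the
  right, the former needs reassociation.\<close>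

definition act12 :: "('a \<times> 'a \<Rightarrow> 'a \<times> 'a) \<Rightarrow> 'a \<times> 'a \<times> 'a \<Rightarrow> 'a \<times> 'a \<times> 'a" where
  "act12 r = (\<lambda>(x, y, z). (fst (r (x, y)), snd (r (x, y)), z))"

definition act23 :: "('a \<times> 'a \<Rightarrow> 'a \<times> 'a) \<Rightarrow> 'a \<times> 'a \<times> 'a \<Rightarrow> 'a \<times> 'a \<times> 'a" where
  "act23 r = map_prod id r"

definition braid_on :: "'a set \<Rightarrow> ('a \<times> 'a \<Rightarrow> 'a \<times> 'a) \<Rightarrow> bool" where
  "braid_on X r \<longleftrightarrow>
     eq_on (X \<times> X \<times> X) (act23 r \<circ> act12 r \<circ> act23 r) (act12 r \<circ> act23 r \<circ> act12 r)"

definition yb_solution :: "'a set \<Rightarrow> ('a \<Rightarrow> 'a \<Rightarrow> 'a) \<Rightarrow> ('a \<Rightarrow> 'a \<Rightarrow> 'a) \<Rightarrow> bool" where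
  "yb_solution X \<sigma> \<tau> \<longleftrightarrow>
     (\<forall>x\<in>X. bij_betw (\<sigma> x) X X) \<and> (\<forall>y\<in>X. bij_betw (\<tau> y) X X) \<and> braid_on X (yb_map \<sigma> \<tau>)"

definition two_permutational :: "'a set \<Rightarrow> ('a \<Rightarrow> 'a \<Rightarrow> 'a) \<Rightarrow> ('a \<Rightarrow> 'a \<Rightarrow> 'a) \<Rightarrow> bool" where
  "two_permutational X \<sigma> \<tau> \<longleftrightarrow>
     (\<forall>x\<in>X. \<forall>y\<in>X. \<forall>z\<in>X.
        eq_on X (\<sigma> (\<sigma> x z)) (\<sigma> (\<sigma> y z)) \<and>
        eq_on X (\<tau> (\<tau> x z)) (\<tau> (\<tau> y z)) \<and>
        eq_on X (\<sigma> (\<tau> x z)) (\<sigma> (\<tau> y z)) \<and>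
        eq_on X (\<tau> (\<sigma> x z)) (\<tau> (\<sigma> y z)))"

definition two_reductive :: "'a set \<Rightarrow> ('a \<Rightarrow> 'a \<Rightarrow> 'a) \<Rightarrow> ('a \<Rightarrow> 'a \<Rightarrow> 'a) \<Rightarrow> bool" where
  "two_reductive X \<sigma> \<tau> \<longleftrightarrow>
     (\<forall>x\<in>X. \<forall>y\<in>X.
        eq_on X (\<sigma> (\<sigma> x y)) (\<sigma> y) \<and>
        eq_on X (\<tau> (\<tau> x y)) (\<tau> y) \<and>
        eq_on X (\<sigma> (\<tau> x y)) (\<sigma> y) \<and>
        eq_on X (\<tau> (\<sigma> x y)) (\<tau> y))"

definition square_free :: "'a set \<Rightarrow> ('a \<Rightarrow> 'a \<Rightarrow> 'a) \<Rightarrow> ('a \<Rightarrow> 'a \<Rightarrow> 'a) \<Rightarrow> bool" where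
  "square_free X \<sigma> \<tau> \<longleftrightarrow> (\<forall>x\<in>X. yb_map \<sigma> \<tau> (x, x) = (x, x))"

definition yb_iso ::
  "'a set \<Rightarrow> ('a \<Rightarrow> 'a \<Rightarrow> 'a) \<Rightarrow> ('a \<Rightarrow> 'a \<Rightarrow> 'a) \<Rightarrow>
   'b set \<Rightarrow> ('b \<Rightarrow> 'b \<Rightarrow> 'b) \<Rightarrow> ('b \<Rightarrow> 'b \<Rightarrow> 'b) \<Rightarrow> ('a \<Rightarrow> 'b) set" where
  "yb_iso X \<sigma> \<tau> X' \<sigma>' \<tau>' =
     {\<Phi>. bij_betw \<Phi> X X' \<and>
         (\<forall>x\<in>X. eq_on X (\<Phi> \<circ> \<sigma> x) (\<sigma>' (\<Phi> x) \<circ> \<Phi>)) \<and>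
         (\<forall>x\<in>X. eq_on X (\<Phi> \<circ> \<tau> x) (\<tau>' (\<Phi> x) \<circ> \<Phi>))}"

definition yb_aut ::
  "'a set \<Rightarrow> ('a \<Rightarrow> 'a \<Rightarrow> 'a) \<Rightarrow> ('a \<Rightarrow> 'a \<Rightarrow> 'a) \<Rightarrow> ('a \<Rightarrow> 'a) set" where
  "yb_aut X \<sigma> \<tau> = yb_iso X \<sigma> \<tau> X \<sigma> \<tau>"

text \<open>The \<open>(\<pi>\<^sub>1, \<pi>\<^sub>2)\<close>-isotope of \<open>(X, L, R)\<close> is \<open>(X, isotope L \<pi>\<^sub>1, isotope R \<pi>\<^sub>2)\<close>.\<close>

definition isotope :: "('a \<Rightarrow> 'a \<Rightarrow> 'a) \<Rightarrow> ('a \<Rightarrow> 'a) \<Rightarrow> 'a \<Rightarrow> 'a \<Rightarrow> 'a" where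
  "isotope S \<pi> = (\<lambda>x. S x \<circ> \<pi>)"

definition isotope_identities ::
  "'a set \<Rightarrow> ('a \<Rightarrow> 'a \<Rightarrow> 'a) \<Rightarrow> ('a \<Rightarrow> 'a \<Rightarrow> 'a) \<Rightarrow> ('a \<Rightarrow> 'a) \<Rightarrow> ('a \<Rightarrow> 'a) \<Rightarrow> bool" where
  "isotope_identities X L R \<pi>\<^sub>1 \<pi>\<^sub>2 \<longleftrightarrow>
     (\<forall>x\<in>X. \<forall>y\<in>X.
        eq_on X (L x \<circ> \<pi>\<^sub>1 \<circ> L y) (L (\<pi>\<^sub>1 y) \<circ> \<pi>\<^sub>1 \<circ> L (\<pi>\<^sub>2 x)) \<and>
        eq_on X (R x \<circ> \<pi>\<^sub>2 \<circ> R y) (R (\<pi>\<^sub>2 y) \<circ> \<pi>\<^sub>2 \<circ> R (\<pi>\<^sub>1 x)) \<and>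
        eq_on X (R (\<pi>\<^sub>1 y) \<circ> \<pi>\<^sub>2 \<circ> L x \<circ> \<pi>\<^sub>1) (L (\<pi>\<^sub>2 x) \<circ> \<pi>\<^sub>1 \<circ> R y \<circ> \<pi>\<^sub>2))"

end

theory Submission
  imports Defs
begin

text \<open>
  Two observations carry the proof. In a 2-reductive solution, \<open>L\<close> and \<open>R\<close> do not change when their
  subscript is moved by some \<open>L\<^sub>x\<close> or \<open>R\<^sub>x\<close>. So in the isotope the subscript \<open>L\<^sub>x (\<pi>\<^sub>1 y)\<close> can always
  be replaced by \<open>\<pi>\<^sub>1 y\<close>, and \<open>R\<^sub>x (\<pi>\<^sub>2 y)\<close> by \<open>\<pi>\<^sub>2 y\<close>; this makes the isotope 2-permutational at once
  and turns the three components of its braid relation into the three isotope identities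
  (\<open>isotope_two_permutational\<close>, \<open>isotope_yb_solution\<close>).

  Square-freeness recovers the twisting bijection from the isotope: \<open>u = \<pi>\<^sub>1 y\<close> is the only solution
  of \<open>L\<^sub>u (\<pi>\<^sub>1 y) = u\<close>, an equation in the isotope alone, because \<open>L\<^sub>u\<close> is injective and fixes \<open>u\<close>.
  Since the isotope determines \<open>\<pi>\<^sub>1\<close> and \<open>\<pi>\<^sub>2\<close>, an isomorphism \<open>\<Phi>\<close> of isotopes intertwines them with
  \<open>\<pi>\<^sub>1'\<close> and \<open>\<pi>\<^sub>2'\<close> (\<open>isotope_hom_intertwines\<close>); cancelling the bijections \<open>\<pi>\<^sub>i\<close> then shows that the
  same \<open>\<Phi>\<close> is an isomorphism of the original solutions (\<open>isotope_hom_iff\<close>). The cancellation can be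
  reversed, so the maps \<open>\<Phi>\<close> and \<open>\<phi>\<close> of the two sides range over the same set.
\<close>

lemma eq_on_comp_inv_into_iff:
  assumes "bij_betw \<phi> X X'" "\<And>x. x \<in> X \<Longrightarrow> \<pi> x \<in> X"
  shows "eq_on X' \<pi>' (\<phi> \<circ> \<pi> \<circ> inv_into X \<phi>) \<longleftrightarrow> (\<forall>x\<in>X. \<phi> (\<pi> x) = \<pi>' (\<phi> x))"
proof -
  have "X' = \<phi> ` X" and "inj_on \<phi> X"
    using assms(1) by (auto simp: bij_betw_def)
  then show ?thesis
    by (auto simp: eq_on_def)
qed

lemma isotope_yb_solution:
  assumes bij: "\<And>x. x \<in> X \<Longrightarrow> bij_betw (L x) X X" "\<And>x. x \<in> X \<Longrightarrow> bij_betw (R x) X X"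
    and red: "two_reductive X L R"
    and pi: "bij_betw \<pi>\<^sub>1 X X" "bij_betw \<pi>\<^sub>2 X X"
    and ids: "isotope_identities X L R \<pi>\<^sub>1 \<pi>\<^sub>2"
  shows "yb_solution X (isotope L \<pi>\<^sub>1) (isotope R \<pi>\<^sub>2)"
proof -
  have [simp]: "\<pi>\<^sub>1 y \<in> X" "\<pi>\<^sub>2 y \<in> X" if "y \<in> X" for y
    using pi that by (auto dest: bij_betwE)
  have [simp]: "L x y \<in> X" "R x y \<in> X" if "x \<in> X" "y \<in> X" for x y
    using bij[OF that(1)] that(2) by (auto dest: bij_betwE)
  have [simp]: "L (L x y) z = L y z" "L (R x y) z = L y z"
      "R (L x y) z = R y z" "R (R x y) z = R y z"
    if "x \<in> X" "y \<in> X" "z \<in> X" for x y z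
    using red that by (auto simp: two_reductive_def eq_on_def)
  have id1: "L x (\<pi>\<^sub>1 (L y z)) = L (\<pi>\<^sub>1 y) (\<pi>\<^sub>1 (L (\<pi>\<^sub>2 x) z))"
   and id2: "R x (\<pi>\<^sub>2 (R y z)) = R (\<pi>\<^sub>2 y) (\<pi>\<^sub>2 (R (\<pi>\<^sub>1 x) z))"
   and id3: "R (\<pi>\<^sub>1 y) (\<pi>\<^sub>2 (L x (\<pi>\<^sub>1 z))) = L (\<pi>\<^sub>2 x) (\<pi>\<^sub>1 (R y (\<pi>\<^sub>2 z)))"
    if "x \<in> X" "y \<in> X" "z \<in> X" for x y z
    using ids that by (auto simp: isotope_identities_def eq_on_def)
  have "(act23 (yb_map (isotope L \<pi>\<^sub>1) (isotope R \<pi>\<^sub>2)) \<circ> act12 (yb_map (isotope L \<pi>\<^sub>1) (isotope R \<pi>\<^sub>2))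
          \<circ> act23 (yb_map (isotope L \<pi>\<^sub>1) (isotope R \<pi>\<^sub>2))) (x, y, z) =
        (act12 (yb_map (isotope L \<pi>\<^sub>1) (isotope R \<pi>\<^sub>2)) \<circ> act23 (yb_map (isotope L \<pi>\<^sub>1) (isotope R \<pi>\<^sub>2))
          \<circ> act12 (yb_map (isotope L \<pi>\<^sub>1) (isotope R \<pi>\<^sub>2))) (x, y, z)"
    if "x \<in> X" "y \<in> X" "z \<in> X" for x y z
    \<comment> \<open>In the third component \<open>x\<close> is the moved point and the subscript \<open>z\<close> is outermost, so the
      identity for \<open>R\<close> is used at the pair \<open>(z, y)\<close>; in the middle component \<open>y\<close> is the moved point.\<close>
    using that id1[of x y "\<pi>\<^sub>1 z"] id2[of z y "\<pi>\<^sub>2 x"] id3[of x z y]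
    by (simp add: act12_def act23_def yb_map_def isotope_def)
  then have "braid_on X (yb_map (isotope L \<pi>\<^sub>1) (isotope R \<pi>\<^sub>2))"
    by (auto simp: braid_on_def eq_on_def)
  then show ?thesis
    using bij pi by (auto simp: yb_solution_def isotope_def intro: bij_betw_trans)
qed

lemma isotope_two_permutational:
  assumes red: "two_reductive X L R"
    and pi: "\<pi>\<^sub>1 ` X \<subseteq> X" "\<pi>\<^sub>2 ` X \<subseteq> X"
  shows "two_permutational X (isotope L \<pi>\<^sub>1) (isotope R \<pi>\<^sub>2)"
proof -
  have "\<pi>\<^sub>1 y \<in> X" "\<pi>\<^sub>2 y \<in> X" if "y \<in> X" for y
    using pi that by auto
  then show ?thesis
    using red by (simp add: two_permutational_def two_reductive_def isotope_def eq_on_def)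
qed

text \<open>
  For \<open>u = \<Phi> (\<pi> y)\<close>, the homomorphism condition at the subscript \<open>\<pi> y\<close> reads
  \<open>u = S'\<^sub>u (\<pi>' (\<Phi> y))\<close>, as \<open>S\<close> fixes \<open>\<pi> y\<close> at that subscript. But \<open>u = S'\<^sub>u u\<close> as well.
\<close>

lemma isotope_hom_intertwines:
  assumes fixed: "\<And>x. x \<in> X \<Longrightarrow> S x x = x" "\<And>u. u \<in> X' \<Longrightarrow> S' u u = u"
    and inj: "\<And>u. u \<in> X' \<Longrightarrow> inj_on (S' u) X'"
    and maps: "\<And>x. x \<in> X \<Longrightarrow> \<pi> x \<in> X" "\<And>u. u \<in> X' \<Longrightarrow> \<pi>' u \<in> X'" "\<And>x. x \<in> X \<Longrightarrow> \<Phi> x \<in> X'"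
    and hom: "\<forall>x\<in>X. eq_on X (\<Phi> \<circ> isotope S \<pi> x) (isotope S' \<pi>' (\<Phi> x) \<circ> \<Phi>)"
    and y: "y \<in> X"
  shows "\<Phi> (\<pi> y) = \<pi>' (\<Phi> y)"
proof -
  have "S' (\<Phi> (\<pi> y)) (\<Phi> (\<pi> y)) = \<Phi> (S (\<pi> y) (\<pi> y))"
    using fixed maps y by simp
  also have "\<dots> = S' (\<Phi> (\<pi> y)) (\<pi>' (\<Phi> y))"
    using hom maps y by (simp add: eq_on_def isotope_def)
  finally show ?thesis
    using inj_onD[OF inj] maps y by blast
qed

text \<open>
  Surjectivity of \<open>\<pi>\<close> lets one test the equality of two maps precomposed with \<open>\<pi>\<close> on all of \<open>X\<close>.
\<close>

lemma isotope_hom_iff: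
  assumes onto: "\<pi> ` X = X"
    and inter: "\<And>y. y \<in> X \<Longrightarrow> \<Phi> (\<pi> y) = \<pi>' (\<Phi> y)"
  shows "eq_on X (\<Phi> \<circ> isotope S \<pi> x) (isotope S' \<pi>' (\<Phi> x) \<circ> \<Phi>) \<longleftrightarrow>
         eq_on X (\<Phi> \<circ> S x) (S' (\<Phi> x) \<circ> \<Phi>)"
proof -
  have "eq_on X (\<Phi> \<circ> isotope S \<pi> x) (isotope S' \<pi>' (\<Phi> x) \<circ> \<Phi>) \<longleftrightarrow>
        (\<forall>y\<in>X. \<Phi> (S x (\<pi> y)) = S' (\<Phi> x) (\<Phi> (\<pi> y)))"
    using inter by (simp add: eq_on_def isotope_def)
  also have "\<dots> \<longleftrightarrow> (\<forall>z\<in>\<pi> ` X. \<Phi> (S x z) = S' (\<Phi> x) (\<Phi> z))"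
    by simp
  finally show ?thesis
    by (simp add: onto eq_on_def)
qed

theorem proposition5p7:
  fixes X :: "'a set" and L R :: "'a \<Rightarrow> 'a \<Rightarrow> 'a" and \<pi>\<^sub>1 \<pi>\<^sub>2 :: "'a \<Rightarrow> 'a"
    and X' :: "'b set" and L' R' :: "'b \<Rightarrow> 'b \<Rightarrow> 'b" and \<pi>\<^sub>1' \<pi>\<^sub>2' :: "'b \<Rightarrow> 'b"
  assumes "yb_solution X L R" "two_reductive X L R" "square_free X L R"
    and "yb_solution X' L' R'" "two_reductive X' L' R'" "square_free X' L' R'"
    and "\<pi>\<^sub>1 \<in> yb_aut X L R" "\<pi>\<^sub>2 \<in> yb_aut X L R"
    and "\<pi>\<^sub>1' \<in> yb_aut X' L' R'" "\<pi>\<^sub>2' \<in> yb_aut X' L' R'"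
    and "isotope_identities X L R \<pi>\<^sub>1 \<pi>\<^sub>2"
    and "isotope_identities X' L' R' \<pi>\<^sub>1' \<pi>\<^sub>2'"
  shows "(yb_solution X (isotope L \<pi>\<^sub>1) (isotope R \<pi>\<^sub>2) \<and>
          two_permutational X (isotope L \<pi>\<^sub>1) (isotope R \<pi>\<^sub>2) \<and>
          yb_solution X' (isotope L' \<pi>\<^sub>1') (isotope R' \<pi>\<^sub>2') \<and>
          two_permutational X' (isotope L' \<pi>\<^sub>1') (isotope R' \<pi>\<^sub>2') \<and>
          (\<exists>\<Phi>. \<Phi> \<in> yb_iso X (isotope L \<pi>\<^sub>1) (isotope R \<pi>\<^sub>2) X' (isotope L' \<pi>\<^sub>1') (isotope R' \<pi>\<^sub>2')))
     \<longleftrightarrow>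
         (\<exists>\<phi>. \<phi> \<in> yb_iso X L R X' L' R' \<and>
              eq_on X' \<pi>\<^sub>1' (\<phi> \<circ> \<pi>\<^sub>1 \<circ> inv_into X \<phi>) \<and>
              eq_on X' \<pi>\<^sub>2' (\<phi> \<circ> \<pi>\<^sub>2 \<circ> inv_into X \<phi>))"
proof -
  have pi: "bij_betw \<pi>\<^sub>1 X X" "bij_betw \<pi>\<^sub>2 X X" "bij_betw \<pi>\<^sub>1' X' X'" "bij_betw \<pi>\<^sub>2' X' X'"
    using assms(7-10) by (auto simp: yb_aut_def yb_iso_def)
  have onto: "\<pi>\<^sub>1 ` X = X" "\<pi>\<^sub>2 ` X = X" "\<pi>\<^sub>1' ` X' = X'" "\<pi>\<^sub>2' ` X' = X'"
    using pi by (auto simp: bij_betw_def)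
  have maps: "\<And>x. x \<in> X \<Longrightarrow> \<pi>\<^sub>1 x \<in> X" "\<And>x. x \<in> X \<Longrightarrow> \<pi>\<^sub>2 x \<in> X"
      "\<And>u. u \<in> X' \<Longrightarrow> \<pi>\<^sub>1' u \<in> X'" "\<And>u. u \<in> X' \<Longrightarrow> \<pi>\<^sub>2' u \<in> X'"
    using onto by auto
  have bij: "\<And>x. x \<in> X \<Longrightarrow> bij_betw (L x) X X" "\<And>x. x \<in> X \<Longrightarrow> bij_betw (R x) X X"
      "\<And>u. u \<in> X' \<Longrightarrow> bij_betw (L' u) X' X'" "\<And>u. u \<in> X' \<Longrightarrow> bij_betw (R' u) X' X'"
    using assms(1,4) by (auto simp: yb_solution_def)
  have inj: "\<And>u. u \<in> X' \<Longrightarrow> inj_on (L' u) X'" "\<And>u. u \<in> X' \<Longrightarrow> inj_on (R' u) X'"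
    using bij by (auto simp: bij_betw_def)
  have fixed: "\<And>x. x \<in> X \<Longrightarrow> L x x = x" "\<And>x. x \<in> X \<Longrightarrow> R x x = x"
      "\<And>u. u \<in> X' \<Longrightarrow> L' u u = u" "\<And>u. u \<in> X' \<Longrightarrow> R' u u = u"
    using assms(3,6) by (auto simp: square_free_def yb_map_def)
  have sol: "yb_solution X (isotope L \<pi>\<^sub>1) (isotope R \<pi>\<^sub>2)"
      "yb_solution X' (isotope L' \<pi>\<^sub>1') (isotope R' \<pi>\<^sub>2')"
    using isotope_yb_solution[OF bij(1,2) assms(2) pi(1,2) assms(11)]
      isotope_yb_solution[OF bij(3,4) assms(5) pi(3,4) assms(12)] by simp_all
  have perm: "two_permutational X (isotope L \<pi>\<^sub>1) (isotope R \<pi>\<^sub>2)"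
      "two_permutational X' (isotope L' \<pi>\<^sub>1') (isotope R' \<pi>\<^sub>2')"
    using assms(2,5) onto by (simp_all add: isotope_two_permutational)
  have "\<Phi> \<in> yb_iso X (isotope L \<pi>\<^sub>1) (isotope R \<pi>\<^sub>2) X' (isotope L' \<pi>\<^sub>1') (isotope R' \<pi>\<^sub>2') \<longleftrightarrow>
        \<Phi> \<in> yb_iso X L R X' L' R' \<and>
        eq_on X' \<pi>\<^sub>1' (\<Phi> \<circ> \<pi>\<^sub>1 \<circ> inv_into X \<Phi>) \<and> eq_on X' \<pi>\<^sub>2' (\<Phi> \<circ> \<pi>\<^sub>2 \<circ> inv_into X \<Phi>)"
    (is "?I \<longleftrightarrow> ?J") for \<Phi>
  proof (cases "bij_betw \<Phi> X X'")
    case True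
    then have \<Phi>: "\<And>x. x \<in> X \<Longrightarrow> \<Phi> x \<in> X'"
      by (auto dest: bij_betwE)
    let ?int = "(\<forall>y\<in>X. \<Phi> (\<pi>\<^sub>1 y) = \<pi>\<^sub>1' (\<Phi> y)) \<and> (\<forall>y\<in>X. \<Phi> (\<pi>\<^sub>2 y) = \<pi>\<^sub>2' (\<Phi> y))"
    have int: ?int if ?I
    proof -
      have "\<forall>x\<in>X. eq_on X (\<Phi> \<circ> isotope L \<pi>\<^sub>1 x) (isotope L' \<pi>\<^sub>1' (\<Phi> x) \<circ> \<Phi>)"
        and "\<forall>x\<in>X. eq_on X (\<Phi> \<circ> isotope R \<pi>\<^sub>2 x) (isotope R' \<pi>\<^sub>2' (\<Phi> x) \<circ> \<Phi>)"
        using that by (auto simp: yb_iso_def)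
      then show ?thesis
        using isotope_hom_intertwines[where S = L and S' = L' and X = X and X' = X'
            and \<Phi> = \<Phi> and \<pi> = \<pi>\<^sub>1 and \<pi>' = \<pi>\<^sub>1']
          isotope_hom_intertwines[where S = R and S' = R' and X = X and X' = X'
            and \<Phi> = \<Phi> and \<pi> = \<pi>\<^sub>2 and \<pi>' = \<pi>\<^sub>2']
          fixed inj maps \<Phi>
        by simp
    qed
    have iff: "?I \<longleftrightarrow> \<Phi> \<in> yb_iso X L R X' L' R'" if ?int
    proof -
      have "eq_on X (\<Phi> \<circ> isotope L \<pi>\<^sub>1 x) (isotope L' \<pi>\<^sub>1' (\<Phi> x) \<circ> \<Phi>) \<longleftrightarrow>
            eq_on X (\<Phi> \<circ> L x) (L' (\<Phi> x) \<circ> \<Phi>)"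
        and "eq_on X (\<Phi> \<circ> isotope R \<pi>\<^sub>2 x) (isotope R' \<pi>\<^sub>2' (\<Phi> x) \<circ> \<Phi>) \<longleftrightarrow>
            eq_on X (\<Phi> \<circ> R x) (R' (\<Phi> x) \<circ> \<Phi>)" for x
        using that by (auto intro!: isotope_hom_iff onto)
      then show ?thesis
        by (simp add: yb_iso_def)
    qed
    have "?J \<longleftrightarrow> \<Phi> \<in> yb_iso X L R X' L' R' \<and> ?int"
      using eq_on_comp_inv_into_iff[OF True maps(1)] eq_on_comp_inv_into_iff[OF True maps(2)]
      by simp
    then show ?thesis
      using int iff by blast
  next
    case False
    then show ?thesis
      by (simp add: yb_iso_def)
  qed
  then show ?thesis
    using sol perm by simp
qed

end
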